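(* Let $P\in\mathbb{R}^{n\times n}$ be an irreducible and aperiodic Markov transition matrix with strictly positive stationary distribution $\pi$, and let $D_\pi=\operatorname{diag}(\pi_1,\dots,\pi_n)$ and $U_{\perp 1}=I_n-\mathbf{1}\pi^\top$. Then for every integer $k\ge 1$, $$\sigma_2(P^k)=\|P^kU_{\perp 1}\|_{\ell^2(\pi)}=\big\|D_\pi^{1/2}P^kU_{\perp 1}D_\pi^{-1/2}\big\|_{\ell^2(\mathbb{R}^n)}.$$
   Context: $P$ is row-stochastic ($n\ge 2$), $\pi^\top P=\pi^\top$, $\pi_i>0$ for all $i$, $\sum_i\pi_i=1$; $\mathbf{1}$ is the all-ones column vector. $\ell^2(\pi)$ is $\mathbb{R}^n$ with inner product $\langle f,g\rangle_\pi=\sum_if_ig_i\pi_i$; for a matrix $A$, $\|A\|_{\ell^2(\pi)}$ is the operator norm induced by the $\ell^2(\pi)$ norm, and $\|A\|_{\ell^2(\mathbb{R}^n)}$ is the Euclidean operator (spectral) norm. $P^*$ is the adjoint of $P$ on $\ell^2(\pi)$, and $\sigma_i(P^k)=\sqrt{\lambda_i(P^k(P^* )^k)}$, where $\lambda_1\ge\dots\ge\lambda_n$ are the eigenvalues of $P^k(P^* )^k$ counted with multiplicity. *)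

theory Defs
  imports "HOL-Analysis.Analysis" "HOL-Computational_Algebra.Polynomial"
begin

text \<open>
  Square real matrices are of type \<open>real^'n^'n\<close>. On this type \<open>*\<close> and \<open>^\<close> act entrywise, so
  matrix powers are defined from the matrix product \<open>**\<close>.
\<close>

primrec matpow :: "'a::semiring_1^'n^'n \<Rightarrow> nat \<Rightarrow> 'a^'n^'n" where
  "matpow A 0 = mat 1"
| "matpow A (Suc k) = A ** matpow A k"

definition row_stochastic :: "real^'n^'n \<Rightarrow> bool" where
  "row_stochastic P \<longleftrightarrow> (\<forall>i j. 0 \<le> P $ i $ j) \<and> (\<forall>i. (\<Sum>j\<in>UNIV. P $ i $ j) = 1)"

definition irreducible_matrix :: "real^'n^'n \<Rightarrow> bool" where
  "irreducible_matrix P \<longleftrightarrow> (\<forall>i j. \<exists>m. matpow P m $ i $ j > 0)"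

definition aperiodic_matrix :: "real^'n^'n \<Rightarrow> bool" where
  "aperiodic_matrix P \<longleftrightarrow> (\<forall>i. Gcd {m::nat. m \<ge> 1 \<and> matpow P m $ i $ i > 0} = 1)"

definition stationary_distribution :: "real^'n \<Rightarrow> real^'n^'n \<Rightarrow> bool" where
  "stationary_distribution \<pi> P \<longleftrightarrow>
     (\<forall>i. 0 \<le> \<pi> $ i) \<and> (\<Sum>i\<in>UNIV. \<pi> $ i) = 1 \<and> \<pi> v* P = \<pi>"

definition diag_mat :: "real^'n \<Rightarrow> real^'n^'n" where
  "diag_mat v = (\<chi> i j. if i = j then v $ i else 0)"

definition U_perp :: "real^'n \<Rightarrow> real^'n^'n" where
  "U_perp \<pi> = mat 1 - (\<chi> i j. \<pi> $ j)"

subsection \<open>The space \<open>\<ell>\<^sup>2(\<pi>)\<close>\<close>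

definition inner_pi :: "real^'n \<Rightarrow> real^'n \<Rightarrow> real^'n \<Rightarrow> real" where
  "inner_pi \<pi> f g = (\<Sum>i\<in>UNIV. f $ i * g $ i * \<pi> $ i)"

definition norm_pi :: "real^'n \<Rightarrow> real^'n \<Rightarrow> real" where
  "norm_pi \<pi> f = sqrt (inner_pi \<pi> f f)"

text \<open>As in \<^const>\<open>onorm\<close>, the argument \<open>f = 0\<close> contributes \<open>0 / 0 = 0\<close>.\<close>

definition onorm_pi :: "real^'n \<Rightarrow> real^'n^'n \<Rightarrow> real" where
  "onorm_pi \<pi> A = (SUP f. norm_pi \<pi> (A *v f) / norm_pi \<pi> f)"

definition adjoint_pi :: "real^'n \<Rightarrow> real^'n^'n \<Rightarrow> real^'n^'n" where
  "adjoint_pi \<pi> A = (THE B. \<forall>f g. inner_pi \<pi> (A *v f) g = inner_pi \<pi> f (B *v g))"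

text \<open>The description in \<^const>\<open>adjoint_pi\<close> is proper when the weights are positive.\<close>

lemma adjoint_pi_exists_unique:
  fixes \<pi> :: "real^'n" and A :: "real^'n^'n"
  assumes "\<And>i. \<pi> $ i > 0"
  shows "\<exists>!B. \<forall>f g. inner_pi \<pi> (A *v f) g = inner_pi \<pi> f (B *v g)"
proof (rule ex1I[where a = "\<chi> i j. \<pi> $ j * A $ j $ i / \<pi> $ i"])
  have nz: "\<pi> $ i \<noteq> 0" for i
    using assms[of i] by simp
  show "\<forall>f g. inner_pi \<pi> (A *v f) g = inner_pi \<pi> f ((\<chi> i j. \<pi> $ j * A $ j $ i / \<pi> $ i) *v g)"
  proof (intro allI)
    fix f g :: "real^'n"
    have "inner_pi \<pi> (A *v f) g = (\<Sum>i\<in>UNIV. \<Sum>j\<in>UNIV. A $ i $ j * f $ j * g $ i * \<pi> $ i)"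
      by (simp add: inner_pi_def matrix_vector_mult_def sum_distrib_right)
    also have "\<dots> = (\<Sum>j\<in>UNIV. \<Sum>i\<in>UNIV. A $ i $ j * f $ j * g $ i * \<pi> $ i)"
      by (rule sum.swap)
    also have "\<dots> = inner_pi \<pi> f ((\<chi> i j. \<pi> $ j * A $ j $ i / \<pi> $ i) *v g)"
      unfolding inner_pi_def matrix_vector_mult_def
      by (simp add: sum_distrib_left sum_distrib_right nz mult.assoc mult.left_commute
          mult.commute)
    finally show "inner_pi \<pi> (A *v f) g
        = inner_pi \<pi> f ((\<chi> i j. \<pi> $ j * A $ j $ i / \<pi> $ i) *v g)" .
  qed
  fix B :: "real^'n^'n"
  assume B: "\<forall>f g. inner_pi \<pi> (A *v f) g = inner_pi \<pi> f (B *v g)"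
  have mult_axis: "(M *v axis j 1) $ i = M $ i $ j" for M :: "real^'n^'n" and i j
    by (metis column_def matrix_vector_mul_component matrix_vector_mult_basis vec_lambda_beta)
  have right: "inner_pi \<pi> (axis i 1) h = h $ i * \<pi> $ i" for h i
    by (simp add: inner_pi_def axis_def if_distrib[of "\<lambda>x. x * _"] cong: if_cong)
  have left: "inner_pi \<pi> h (axis j 1) = h $ j * \<pi> $ j" for h j
    by (simp add: inner_pi_def axis_def if_distrib[of "\<lambda>x. x * _"] if_distrib[of "\<lambda>x. _ * x"]
        cong: if_cong)
  have "B $ i $ j * \<pi> $ i = A $ j $ i * \<pi> $ j" for i j
    using B[rule_format, of "axis i 1" "axis j 1"] by (simp add: left right mult_axis)
  then show "B = (\<chi> i j. \<pi> $ j * A $ j $ i / \<pi> $ i)"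
    using nz by (simp add: vec_eq_iff field_simps)
qed

subsection \<open>Ordered eigenvalues and singular values\<close>

definition charpoly :: "real^'n^'n \<Rightarrow> real poly" where
  "charpoly A = det (mat [:0, 1:] - (\<chi> i j. [:A $ i $ j:]))"

text \<open>
  \<open>eigval A i\<close> is the \<open>i\<close>-th largest eigenvalue, with \<open>i\<close> starting at 1 and repetitions according
  to algebraic multiplicity. Only the real eigenvalues are listed, so this is meant for matrices
  with real spectrum, such as those which are self-adjoint on \<open>\<ell>\<^sup>2(\<pi>)\<close>.
\<close>

definition eigval :: "real^'n^'n \<Rightarrow> nat \<Rightarrow> real" where
  "eigval A i = rev (sorted_list_of_multiset (proots (charpoly A))) ! (i - 1)"

text \<open>\<open>sing_val \<pi> P k i\<close> is \<open>\<sigma>\<^sub>i(P\<^sup>k)\<close>, taken with respect to \<open>\<ell>\<^sup>2(\<pi>)\<close>.\<close>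

definition sing_val :: "real^'n \<Rightarrow> real^'n^'n \<Rightarrow> nat \<Rightarrow> nat \<Rightarrow> real" where
  "sing_val \<pi> P k i = sqrt (eigval (matpow P k ** matpow (adjoint_pi \<pi> P) k) i)"

end

theory Submission
  imports Defs
begin

text \<open>
  Conjugation by \<open>D = D\<^sub>\<pi>\<^sup>1\<^sup>/\<^sup>2\<close> is an isometry from \<open>\<ell>\<^sup>2(\<pi>)\<close> to Euclidean space; it turns \<open>P\<^sup>k\<close> into a
  contraction \<open>S\<close> and \<open>P\<^sup>k(P\<^sup>*)\<^sup>k\<close> into \<open>S S\<^sup>T\<close>. The unit vector \<open>u = \<surd>\<pi>\<close> is fixed by both \<open>S\<close> and
  \<open>S\<^sup>T\<close>, and \<open>P\<^sup>k U\<close> becomes \<open>T = S - u u\<^sup>T\<close>. In an orthonormal eigenbasis of \<open>S S\<^sup>T\<close> that contains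
  \<open>u\<close>, the matrix \<open>T T\<^sup>T\<close> is obtained from \<open>S S\<^sup>T\<close> by replacing the eigenvalue 1 of \<open>u\<close>, which is
  the largest because \<open>S\<close> is a contraction, by 0. Hence the largest eigenvalue of \<open>T T\<^sup>T\<close> is the
  second one of \<open>S S\<^sup>T\<close>.
\<close>

section \<open>Matrix powers and distributivity\<close>

lemma matpow_commute: "A ** matpow A k = matpow A k ** A"
proof (induction k)
  case (Suc k)
  then show ?case
    by (metis matpow.simps(2) matrix_mul_assoc)
qed simp

lemma transpose_matpow: "transpose (matpow A k) = matpow (transpose A) k"
  for A :: "'a::comm_semiring_1^'n^'n"
  by (induction k) (simp_all add: matrix_transpose_mul matpow_commute)

lemma matpow_conj:
  assumes "E ** D = mat 1" "D ** E = mat 1"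
  shows "D ** matpow A k ** E = matpow (D ** A ** E) k"
proof (induction k)
  case (Suc k)
  have "D ** matpow A (Suc k) ** E = (D ** A ** (E ** D)) ** matpow A k ** E"
    by (simp add: assms(1) matrix_mul_assoc)
  also have "\<dots> = (D ** A ** E) ** (D ** matpow A k ** E)"
    by (simp only: matrix_mul_assoc)
  finally show ?case using Suc by simp
qed (simp add: assms)

lemma matpow_fixed: "A *v x = x \<Longrightarrow> matpow A k *v x = x"
  by (induction k) (simp_all add: matrix_vector_mul_assoc[symmetric])

lemma matrix_mult_diff_distrib:
  fixes A B :: "'a::ring_1^'n^'m"
  shows matrix_diff_rdistrib: "(A - B) ** C = A ** C - B ** C"
    and matrix_diff_ldistrib: "X ** (A - B) = X ** A - X ** B"
  by (simp_all add: matrix_matrix_mult_def vec_eq_iff left_diff_distrib right_diff_distrib sum_subtractf)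

subsection \<open>Characteristic polynomials\<close>

text \<open>Lifting entries to constant polynomials respects products, and the lift of
  \<open>D\<close> commutes with scalar matrices. So the characteristic matrix of \<open>A\<close>
  is only multiplied by the lifts of \<open>D\<close> and \<open>E\<close>, whose determinants have
  product 1.\<close>

lemma charpoly_similar:
  fixes A D E :: "real^'n^'n"
  assumes "D ** E = mat 1"
  shows "charpoly (D ** A ** E) = charpoly A"
proof -
  define C :: "real^'n^'n \<Rightarrow> real poly^'n^'n" where "C = (\<lambda>A. \<chi> i j. [:A $ i $ j:])"
  have C_app: "C X = (\<chi> i j. [:X $ i $ j:])" for X
    by (simp add: C_def)
  have C_mult: "C (X ** Y) = C X ** C Y" for X Y
  proof -
    have "[:(\<Sum>k\<in>UNIV. X $ i $ k * Y $ k $ j):] = (\<Sum>k\<in>UNIV. [:X $ i $ k:] * [:Y $ k $ j:])" for i j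
      by (rule poly_eqI) (simp add: coeff_sum coeff_pCons mult.commute split: nat.split)
    then show ?thesis
      by (simp add: C_def matrix_matrix_mult_def vec_eq_iff)
  qed
  have DE: "C D ** C E = mat 1"
    unfolding C_mult[symmetric] assms by (simp add: C_def mat_def vec_eq_iff one_pCons)
  have comm: "C D ** mat c = mat c ** C D" for c
    by (simp add: matrix_matrix_mult_def mat_def vec_eq_iff mult.commute
        if_distrib[of "\<lambda>x. x * _"] if_distrib[of "\<lambda>x. _ * x"] cong: if_cong)
  have "mat [:0,1:] - C (D ** A ** E) = C D ** (mat [:0,1:] - C A) ** C E"
    by (simp add: C_mult matrix_mult_diff_distrib comm matrix_mul_assoc[symmetric] DE)
  moreover have "det (C D) * det (C E) = 1"
    using arg_cong[OF DE, of det] by (simp add: det_mul)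
  ultimately show ?thesis
    by (simp add: charpoly_def flip: C_app) (simp add: det_mul mult.commute mult.left_commute)
qed

lemma charpoly_diag_mat: "charpoly (diag_mat d) = (\<Prod>i\<in>UNIV. [:- d $ i, 1:])"
  unfolding charpoly_def by (subst det_diagonal) (simp_all add: diag_mat_def mat_def)

lemma proots_charpoly_diag_mat: "proots (charpoly (diag_mat d)) = (\<Sum>i\<in>UNIV. {#d $ i#})"
  by (simp add: charpoly_diag_mat proots_prod)

subsection \<open>The spectral theorem for symmetric matrices\<close>

lemma dot_transpose: "(A *v x) \<bullet> y = x \<bullet> (transpose A *v y)" for A :: "real^'n^'m"
  by (metis dot_lmul_matrix inner_commute transpose_matrix_vector)

text \<open>A maximiser of the Rayleigh quotient on the unit sphere of \<open>W\<close> is an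
  eigenvector. Working inside an invariant subspace allows new eigenvectors to be chosen orthogonal
  to earlier ones.\<close>

lemma symmetric_eigenvector_exists:
  fixes N :: "real^'n^'n"
  assumes sym: "transpose N = N" and W: "subspace W" "W \<noteq> {0}"
    and inv: "\<And>x. x \<in> W \<Longrightarrow> N *v x \<in> W"
  obtains x m where "x \<in> W" "norm x = 1" "N *v x = m *\<^sub>R x"
proof -
  define S where "S = W \<inter> sphere 0 1"
  obtain y where y: "y \<in> W" "y \<noteq> 0"
    using W subspace_0 by blast
  then have "y /\<^sub>R norm y \<in> S"
    using W by (simp add: S_def subspace_scale)
  moreover have "compact S"
    unfolding S_def using closed_subspace[OF W(1)] by (simp add: closed_Int_compact)
  moreover have "continuous_on S (\<lambda>x. x \<bullet> (N *v x))"
    by (intro continuous_intros)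
  ultimately obtain x where x: "x \<in> S" and max: "\<And>y. y \<in> S \<Longrightarrow> y \<bullet> (N *v y) \<le> x \<bullet> (N *v x)"
    using continuous_attains_sup by (metis empty_iff)
  define m where "m = x \<bullet> (N *v x)"
  \<comment> \<open>By homogeneity \<open>q\<close> is nonnegative on all of \<open>W\<close>; it
    vanishes at \<open>x\<close>, which therefore minimises it.\<close>
  define q where "q = (\<lambda>y. m * (y \<bullet> y) - y \<bullet> (N *v y))"
  have xW: "x \<in> W" and x1: "norm x = 1"
    using x by (auto simp: S_def)
  have xx: "x \<bullet> x = 1"
    using x1 by (simp add: dot_square_norm)
  have q_nonneg: "q y \<ge> 0" if "y \<in> W" for y
  proof (cases "y = 0")
    case False
    then have "y /\<^sub>R norm y \<in> S"
      using W that by (simp add: S_def subspace_scale)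
    from max[OF this] have "(y \<bullet> (N *v y)) / (norm y)\<^sup>2 \<le> m"
      by (simp add: m_def matrix_vector_mult_scaleR power2_eq_square divide_inverse mult.commute mult.left_commute)
    then show ?thesis
      using False by (simp add: q_def field_simps dot_square_norm)
  qed (simp add: q_def)
  \<comment> \<open>Half the gradient of \<open>q\<close> at \<open>x\<close>. It lies in
    \<open>W\<close>, so minimality forces it to vanish.\<close>
  define w where "w = m *\<^sub>R x - N *v x"
  have wW: "w \<in> W"
    unfolding w_def using W xW inv by (simp add: subspace_diff subspace_scale)
  have symm: "x \<bullet> (N *v w) = (N *v x) \<bullet> w"
    using dot_transpose[of N x w] sym by simp
  \<comment> \<open>First-order optimality of \<open>x\<close> in the direction \<open>w\<close>.\<close>
  have expand: "q (x + t *\<^sub>R w) = 2 * t * (w \<bullet> w) + t\<^sup>2 * q w" for t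
  proof -
    have w2: "w \<bullet> w = m * (x \<bullet> w) - (N *v x) \<bullet> w"
      using w_def by (metis inner_diff_left inner_scaleR_left)
    have "q (x + t *\<^sub>R w) = 2 * t * (m * (x \<bullet> w) - (N *v x) \<bullet> w) + t\<^sup>2 * q w"
      using symm unfolding q_def
      by (simp add: matrix_vector_right_distrib matrix_vector_mult_scaleR inner_add_left inner_add_right
          xx m_def[symmetric] algebra_simps power2_eq_square inner_commute)
    then show ?thesis
      unfolding w2 .
  qed
  have "w \<bullet> w = 0"
  proof -
    define b where "b = w \<bullet> w"
    \<comment> \<open>This choice turns the quadratic into \<open>- t\<^sup>2 * (q w + 2)\<close>;
      the \<open>+ 1\<close> keeps the denominator positive when \<open>q w = 0\<close>.\<close>
    define t where "t = - b / (q w + 1)"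
    have qw: "q w \<ge> 0" using q_nonneg wW by blast
    have "0 \<le> q (x + t *\<^sub>R w)"
      using W xW wW by (intro q_nonneg subspace_add subspace_scale)
    then have "0 \<le> 2 * t * b + t\<^sup>2 * q w"
      unfolding expand b_def .
    also have b: "b = - (t * (q w + 1))"
      using qw by (simp add: t_def)
    finally have "t\<^sup>2 * (q w + 2) \<le> 0"
      by (simp add: algebra_simps power2_eq_square)
    then have "t = 0"
      using qw by (simp add: mult_le_0_iff)
    then show ?thesis
      using b by (simp add: b_def)
  qed
  then have "N *v x = m *\<^sub>R x"
    by (simp add: w_def)
  then show ?thesis
    using that xW x1 by blast
qed

text \<open>An orthonormal set of eigenvectors that contains \<open>u\<close> and has maximal
  cardinality is a basis: otherwise its orthogonal complement, invariant by symmetry, holds a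
  further eigenvector. Prescribing \<open>u\<close> lets it be split off later.\<close>

lemma spectral_theorem_symmetric:
  fixes N :: "real^'n^'n" and u :: "real^'n"
  assumes sym: "transpose N = N" and u: "norm u = 1" "N *v u = c *\<^sub>R u"
  obtains v :: "'n \<Rightarrow> real^'n" and d i\<^sub>0 where
    "\<And>i. N *v v i = d $ i *\<^sub>R v i" "\<And>i j. v i \<bullet> v j = (if i = j then 1 else 0)" "v i\<^sub>0 = u"
proof -
  define ok where "ok = (\<lambda>B. u \<in> B \<and> (\<forall>x\<in>B. norm x = 1 \<and> (\<exists>m. N *v x = m *\<^sub>R x))
      \<and> pairwise orthogonal B)"
  have ok_indep: "independent B" if "ok B" for B
    using that by (intro pairwise_orthogonal_independent) (auto simp: ok_def)
  have "ok {u}"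
    using u by (auto simp: ok_def)
  moreover have "card B \<le> CARD('n)" if "ok B" for B
    using independent_bound[OF ok_indep[OF that]] by simp
  ultimately obtain B where B: "ok B" and max: "\<And>C. ok C \<Longrightarrow> card C \<le> card B"
    using ex_has_greatest_nat[of ok "{u}" card "Suc CARD('n)"] by (auto simp: less_Suc_eq_le)
  have finB: "finite B"
    using independent_bound[OF ok_indep[OF B]] by simp
  have "card B = CARD('n)"
  proof (rule ccontr)
    assume "card B \<noteq> CARD('n)"
    then have "dim (span B) < DIM(real^'n)"
      using independent_bound[OF ok_indep[OF B]] dim_eq_card_independent[OF ok_indep[OF B]]
      by (simp add: dim_span)
    then obtain y where y: "y \<noteq> 0" "\<And>x. x \<in> span B \<Longrightarrow> orthogonal y x"
      using orthogonal_to_subspace_exists[of "span B"] by (metis span_span)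
    define W where "W = {x. \<forall>b\<in>B. orthogonal x b}"
    have "y \<in> W"
      using y span_base by (auto simp: W_def)
    then have "W \<noteq> {0}"
      using y by auto
    moreover have "subspace W"
      by (auto simp: W_def subspace_def orthogonal_def inner_add_left)
    moreover have "N *v x \<in> W" if x: "x \<in> W" for x
    proof -
      have "(N *v x) \<bullet> b = 0" if "b \<in> B" for b
      proof -
        obtain m where "N *v b = m *\<^sub>R b"
          using B \<open>b \<in> B\<close> unfolding ok_def by blast
        then show ?thesis
          using dot_transpose[of N x b] sym x \<open>b \<in> B\<close> by (simp add: W_def orthogonal_def)
      qed
      then show ?thesis
        by (simp add: W_def orthogonal_def)
    qed
    ultimately obtain x m where x: "x \<in> W" "norm x = 1" "N *v x = m *\<^sub>R x"
      using symmetric_eigenvector_exists[OF sym] by metis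
    have "x \<notin> B"
      using x by (auto simp: W_def orthogonal_def)
    moreover have "ok (insert x B)"
      using B x unfolding ok_def by (auto simp: pairwise_insert W_def orthogonal_commute)
    ultimately show False
      using max[of "insert x B"] finB by simp
  qed
  then obtain v where v: "bij_betw v (UNIV :: 'n set) B"
    using finite_same_card_bij[OF _ finB] by (metis finite)
  then have vB: "v i \<in> B" for i
    by (auto simp: bij_betw_def)
  obtain i\<^sub>0 where "v i\<^sub>0 = u"
    using v B by (metis (no_types) bij_betw_def imageE ok_def)
  moreover have "v i \<bullet> v j = (if i = j then 1 else 0)" for i j
  proof (cases "i = j")
    case True
    then show ?thesis using B vB[of j] by (simp add: ok_def dot_square_norm)
  next
    case False
    then have "v i \<noteq> v j"
      using v by (auto simp: bij_betw_def inj_on_def)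
    then show ?thesis
      using False B vB by (auto simp: ok_def pairwise_def orthogonal_def)
  qed
  moreover have "\<exists>m. N *v v i = m *\<^sub>R v i" for i
    using B vB unfolding ok_def by blast
  then obtain m where "\<And>i. N *v v i = m i *\<^sub>R v i"
    by metis
  then have "N *v v i = (\<chi> i. m i) $ i *\<^sub>R v i" for i
    by simp
  ultimately show ?thesis
    using that by blast
qed

text \<open>The orthogonal matrix \<open>Q\<close> with columns \<open>v i\<close> diagonalises
  \<open>N\<close>, so similarity reduces the claim to \<open>diag_mat d\<close>. Multiplicities are
  carried by repeated entries of \<open>d\<close>.\<close>

lemma proots_charpoly_eigenbasis:
  fixes N :: "real^'n^'n" and v :: "'n \<Rightarrow> real^'n"
  assumes eig: "\<And>i. N *v v i = d $ i *\<^sub>R v i"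
    and orth: "\<And>i j. v i \<bullet> v j = (if i = j then 1 else 0)"
  shows "proots (charpoly N) = (\<Sum>i\<in>UNIV. {#d $ i#})"
proof -
  define Q :: "real^'n^'n" where "Q = (\<chi> i j. v j $ i)"
  have QQ: "transpose Q ** Q = mat 1"
    by (simp add: vec_eq_iff Q_def matrix_matrix_mult_def transpose_def mat_def orth inner_vec_def[symmetric]
        flip: inner_real_def)
  have "(N ** Q) $ i $ j = (Q ** diag_mat d) $ i $ j" for i j
  proof -
    have "(N ** Q) $ i $ j = (N *v v j) $ i"
      by (simp add: matrix_matrix_mult_def matrix_vector_mult_def Q_def)
    then show ?thesis
      by (simp add: eig Q_def matrix_matrix_mult_def diag_mat_def if_distrib[of "\<lambda>x. _ * x"] cong: if_cong)
  qed
  then have "N ** Q = Q ** diag_mat d"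
    by (simp add: vec_eq_iff)
  then have "transpose Q ** N ** Q = diag_mat d"
    by (metis QQ matrix_mul_assoc matrix_mul_lid)
  then show ?thesis
    using charpoly_similar[OF QQ, of N] proots_charpoly_diag_mat by metis
qed

text \<open>For the square matrix \<open>Q\<close> with columns \<open>v i\<close>, the left inverse
  \<open>transpose Q\<close> is also a right inverse, and \<open>Q *v (transpose Q *v x)\<close> is
  the expansion.\<close>

lemma orthonormal_family_expand:
  fixes v :: "'n \<Rightarrow> real^'n"
  assumes orth: "\<And>i j. v i \<bullet> v j = (if i = j then 1 else 0)"
  shows "(\<Sum>i\<in>UNIV. (x \<bullet> v i) *\<^sub>R v i) = x"
proof -
  define Q :: "real^'n^'n" where "Q = (\<chi> i j. v j $ i)"
  have "transpose Q ** Q = mat 1"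
    by (simp add: vec_eq_iff Q_def matrix_matrix_mult_def transpose_def mat_def orth inner_vec_def[symmetric]
        flip: inner_real_def)
  then have "Q *v (transpose Q *v x) = x"
    by (metis matrix_left_right_inverse matrix_vector_mul_assoc matrix_vector_mul_lid)
  moreover have "(transpose Q *v x) $ i = x \<bullet> v i" for i
    by (simp add: Q_def transpose_def matrix_vector_mult_def inner_vec_def mult.commute del: transpose_matrix_vector)
  ultimately show ?thesis
    by (simp add: vec_eq_iff matrix_vector_mult_def Q_def mult.commute del: transpose_matrix_vector)
qed

section \<open>Operator norms, the second eigenvalue and deflation\<close>

lemma onorm_transpose: "onorm ((*v) (transpose A)) = onorm ((*v) A)" for A :: "real^'n^'m"
proof -
  have *: "onorm ((*v) (transpose A)) \<le> onorm ((*v) A)" for A :: "real^'a^'b"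
  proof (rule onorm_le)
    fix x
    have "(norm (transpose A *v x))\<^sup>2 = (A *v (transpose A *v x)) \<bullet> x"
      using dot_transpose[of A "transpose A *v x" x] by (simp only: dot_square_norm)
    also have "\<dots> \<le> norm (A *v (transpose A *v x)) * norm x"
      by (rule norm_cauchy_schwarz)
    also have "\<dots> \<le> onorm ((*v) A) * norm (transpose A *v x) * norm x"
      by (intro mult_right_mono onorm) auto
    finally show "norm (transpose A *v x) \<le> onorm ((*v) A) * norm x"
      by (cases "norm (transpose A *v x) = 0")
        (auto simp: power2_eq_square onorm_pos_le simp del: transpose_matrix_vector)
  qed
  show ?thesis
    using *[of A] *[of "transpose A"] by simp
qed

text \<open>Deleting a single occurrence of the top value makes the second largest entry the
  largest. A repeated top value survives among the other indices, as multiplicity requires.\<close>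

lemma eigval_2_of_top:
  fixes d :: "real^'n"
  assumes "proots (charpoly A) = (\<Sum>i\<in>UNIV. {#d $ i#})"
    and "CARD('n) \<ge> 2" and top: "\<And>i. d $ i \<le> d $ i\<^sub>0"
  shows "eigval A 2 = Max ((\<lambda>i. d $ i) ` (UNIV - {i\<^sub>0}))"
proof -
  define M where "M = (\<Sum>i\<in>UNIV - {i\<^sub>0}. {#d $ i#})"
  define xs where "xs = sorted_list_of_multiset M"
  have set_M: "set_mset M = (\<lambda>i. d $ i) ` (UNIV - {i\<^sub>0})"
    by (auto simp: M_def set_mset_sum)
  have "UNIV - {i\<^sub>0} \<noteq> {}"
    using assms(2) card_mono[of "{i\<^sub>0}" UNIV] by force
  then have "xs \<noteq> []"
    using set_M unfolding xs_def by (metis image_is_empty set_empty set_sorted_list_of_multiset)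
  have "sorted_list_of_multiset (proots (charpoly A)) = sort (xs @ [d $ i\<^sub>0])"
    unfolding assms(1) M_def xs_def
    by (subst sum.remove[of _ i\<^sub>0]) (simp_all flip: sorted_list_of_multiset_mset)
  also have "\<dots> = xs @ [d $ i\<^sub>0]"
    using top set_M by (intro sorted_sort_id) (auto simp: xs_def sorted_append)
  \<comment> \<open>\<open>eigval A 2\<close> reads position 1 of the reversed list; the deleted top
    value sits at position 0, hence the shift.\<close>
  finally have "eigval A 2 = rev xs ! 0"
    by (simp add: eigval_def)
  also have "\<dots> = last xs"
    using \<open>xs \<noteq> []\<close> by (simp add: rev_nth last_conv_nth)
  also have "\<dots> = Max (set xs)"
  proof (rule Max_eqI[symmetric])
    have "sorted xs"
      by (simp add: xs_def)
    then show "y \<le> last xs" if "y \<in> set xs" for y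
      using that by (induction xs) auto
  qed (use \<open>xs \<noteq> []\<close> in auto)
  finally show ?thesis
    by (simp add: xs_def set_M)
qed

text \<open>Passing to \<open>transpose T\<close> brings in \<open>S ** transpose S\<close>: its
  squared norm at \<open>x\<close> is the quadratic form of that matrix at the projection of
  \<open>x\<close> orthogonal to \<open>u\<close>.\<close>

lemma sqrt_eigval_2_eq_onorm_deflated:
  fixes S :: "real^'n^'n" and u :: "real^'n"
  assumes card: "CARD('n) \<ge> 2" and u1: "norm u = 1"
    and Su: "S *v u = u" and Stu: "transpose S *v u = u"
    and contr: "\<And>x. norm (S *v x) \<le> norm x"
  shows "sqrt (eigval (S ** transpose S) 2) = onorm ((*v) (S - (\<chi> i j. u $ i * u $ j)))"
proof -
  define N where "N = S ** transpose S"
  define T where "T = S - (\<chi> i j. u $ i * u $ j)"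
  have "transpose N = N"
    by (simp add: N_def matrix_transpose_mul)
  moreover have "N *v u = 1 *\<^sub>R u"
    unfolding N_def by (simp add: Stu Su flip: matrix_vector_mul_assoc del: transpose_matrix_vector)
  ultimately obtain v :: "'n \<Rightarrow> real^'n" and d i\<^sub>0 where eig: "\<And>i. N *v v i = d $ i *\<^sub>R v i"
    and orth: "\<And>i j. v i \<bullet> v j = (if i = j then 1 else 0)" and i0: "v i\<^sub>0 = u"
    using spectral_theorem_symmetric[OF _ u1] by metis
  define I where "I = UNIV - {i\<^sub>0}"
  define \<mu> where "\<mu> = Max ((\<lambda>i. d $ i) ` I)"
  have "I \<noteq> {}"
    unfolding I_def using card card_mono[of "{i\<^sub>0}" UNIV] by force
  have norm_v: "norm (v i) = 1" for i
    using orth[of i i] by (simp add: norm_eq_1)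
  have tS: "(norm (transpose S *v x))\<^sup>2 = x \<bullet> (N *v x)" for x
    unfolding N_def using dot_transpose[of "transpose S" x "transpose S *v x"]
    by (simp add: dot_square_norm matrix_vector_mul_assoc del: transpose_matrix_vector)
  have d: "d $ i = (norm (transpose S *v v i))\<^sup>2" for i
    unfolding tS by (simp add: eig dot_square_norm norm_v)
  have "onorm ((*v) (transpose S)) \<le> 1"
    unfolding onorm_transpose using contr by (intro onorm_le) auto
  then have contr': "norm (transpose S *v x) \<le> norm x" for x
    using onorm[OF matrix_vector_mul_bounded_linear, of "transpose S" x]
    by (meson mult_left_le_one_le norm_ge_zero onorm_pos_le matrix_vector_mul_bounded_linear order_trans)
  \<comment> \<open>\<open>transpose S\<close> fixes \<open>u\<close>, so
    \<open>d $ i\<^sub>0\<close> is 1, while contraction bounds every \<open>d $ i\<close> by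
    1.\<close>
  have d_le: "d $ i \<le> d $ i\<^sub>0" for i
    using contr'[of "v i"] by (simp add: d i0 Stu u1 norm_v power_le_one del: transpose_matrix_vector)
  have \<mu>_ge: "d $ i \<le> \<mu>" if "i \<in> I" for i
    using that unfolding \<mu>_def by simp
  have "\<mu> \<in> (\<lambda>i. d $ i) ` I"
    using \<open>I \<noteq> {}\<close> by (simp add: \<mu>_def)
  then obtain i\<^sub>1 where i1: "i\<^sub>1 \<in> I" "d $ i\<^sub>1 = \<mu>"
    by auto
  have \<mu>_nonneg: "\<mu> \<ge> 0"
    using i1 d by (metis zero_le_power2)
  have T: "transpose T *v x = transpose S *v x - (u \<bullet> x) *\<^sub>R u" for x
    by (simp add: T_def vec_eq_iff transpose_def matrix_vector_mult_def inner_vec_def algebra_simps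
        sum_subtractf sum_distrib_left sum_distrib_right del: transpose_matrix_vector)
  \<comment> \<open>As \<open>transpose S\<close> fixes \<open>u\<close>, the component along
    \<open>u\<close> can be removed before applying it.\<close>
  have T': "transpose T *v x = transpose S *v (x - (u \<bullet> x) *\<^sub>R u)" for x
    by (simp add: T matrix_vector_mult_diff_distrib matrix_vector_mult_scaleR Stu del: transpose_matrix_vector)
  have "onorm ((*v) (transpose T)) = sqrt \<mu>"
  proof (rule antisym)
    show "onorm ((*v) (transpose T)) \<le> sqrt \<mu>"
    proof (rule onorm_le)
      fix x
      define y where "y = x - (u \<bullet> x) *\<^sub>R u"
      have uu: "u \<bullet> u = 1"
        using u1 by (simp add: norm_eq_1)
      have y0: "y \<bullet> v i\<^sub>0 = 0"
        by (simp add: y_def i0 inner_diff_left uu inner_commute[of x u])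
      have y_sq: "y \<bullet> z = (\<Sum>i\<in>UNIV. (y \<bullet> v i) * (v i \<bullet> z))" for z
        by (subst orthonormal_family_expand[OF orth, of y, symmetric])
          (simp add: inner_sum_left)
      have "(norm (transpose T *v x))\<^sup>2 = y \<bullet> (N *v y)"
        by (simp only: T' tS y_def)
      also have "\<dots> = (\<Sum>i\<in>UNIV. d $ i * (y \<bullet> v i)\<^sup>2)"
      proof -
        have "v i \<bullet> (N *v y) = d $ i * (y \<bullet> v i)" for i
          using dot_transpose[of N "v i" y] \<open>transpose N = N\<close> by (simp add: eig inner_commute)
        then show ?thesis
          unfolding y_sq[of "N *v y"] by (simp add: power2_eq_square mult.left_commute)
      qed
      also have "\<dots> \<le> (\<Sum>i\<in>UNIV. \<mu> * (y \<bullet> v i)\<^sup>2)"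
      proof (rule sum_mono)
        \<comment> \<open>The bound by \<mu> may fail at \<open>i\<^sub>0\<close>, but there the
          coefficient vanishes because \<open>y\<close> is orthogonal to \<open>u\<close>.\<close>
        show "d $ i * (y \<bullet> v i)\<^sup>2 \<le> \<mu> * (y \<bullet> v i)\<^sup>2" for i
          using \<mu>_ge[of i] y0 by (cases "i = i\<^sub>0") (auto simp: I_def intro: mult_right_mono)
      qed
      also have "\<dots> = \<mu> * (y \<bullet> y)"
        by (simp add: y_sq[of y] power2_eq_square inner_commute sum_distrib_left)
      also have "\<dots> \<le> \<mu> * (x \<bullet> x)"
      proof (rule mult_left_mono[OF _ \<mu>_nonneg])
        have "y \<bullet> y = x \<bullet> x - (u \<bullet> x)\<^sup>2"
          by (simp add: y_def inner_diff_left inner_diff_right uu inner_commute power2_eq_square)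
        then show "y \<bullet> y \<le> x \<bullet> x"
          by simp
      qed
      also have "\<dots> = (sqrt \<mu> * norm x)\<^sup>2"
        using \<mu>_nonneg by (simp add: power_mult_distrib dot_square_norm)
      finally show "norm (transpose T *v x) \<le> sqrt \<mu> * norm x"
        by (rule power2_le_imp_le) (use \<mu>_nonneg in simp)
    qed
  next
    \<comment> \<open>The bound is attained at \<open>v i\<^sub>1\<close>: being orthogonal to
      \<open>u\<close>, it does not see the deflation.\<close>
    have "u \<bullet> v i\<^sub>1 = 0"
      using i1 orth[of i\<^sub>0 i\<^sub>1] by (auto simp: i0 I_def)
    then have "sqrt \<mu> = norm (transpose T *v v i\<^sub>1)"
      using i1(2) by (simp add: T d del: transpose_matrix_vector flip: i1(2))
    also have "\<dots> \<le> onorm ((*v) (transpose T))"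
      using onorm[OF matrix_vector_mul_bounded_linear, of "transpose T" "v i\<^sub>1"] by (simp only: norm_v mult_1_right)
    finally show "sqrt \<mu> \<le> onorm ((*v) (transpose T))" .
  qed
  moreover have "eigval N 2 = \<mu>"
    unfolding \<mu>_def I_def
    using eigval_2_of_top[OF proots_charpoly_eigenbasis[OF eig orth] card d_le] .
  ultimately show ?thesis
    unfolding T_def[symmetric] N_def[symmetric] by (metis onorm_transpose)
qed

subsection \<open>Transfer between \<open>\<ell>\<^sup>2(\<pi>)\<close> and Euclidean space\<close>

lemma diag_mat_mult_vec: "(diag_mat a *v x) $ i = a $ i * x $ i"
  by (simp add: diag_mat_def matrix_vector_mult_def if_distrib[of "\<lambda>x. x * _"] cong: if_cong)

lemma diag_mat_mult_left: "(diag_mat a ** A) $ i $ j = a $ i * A $ i $ j"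
  by (simp add: diag_mat_def matrix_matrix_mult_def if_distrib[of "\<lambda>x. x * _"] cong: if_cong)

lemma diag_mat_mult_right: "(A ** diag_mat a) $ i $ j = A $ i $ j * a $ j"
  by (simp add: diag_mat_def matrix_matrix_mult_def if_distrib[of "\<lambda>x. _ * x"] cong: if_cong)

lemma norm_pi_eq_norm:
  assumes "\<And>i. (a $ i)\<^sup>2 = \<pi> $ i"
  shows "norm_pi \<pi> f = norm (diag_mat a *v f)"
  by (simp add: norm_pi_def norm_eq_sqrt_inner inner_vec_def inner_pi_def diag_mat_mult_vec
      power2_eq_square ac_simps flip: assms)

text \<open>\<open>E\<close> is onto, so the supremum may run over \<open>f = E *v x\<close>, whose
  weighted norm is the Euclidean norm of \<open>x\<close>.\<close>

lemma onorm_pi_eq_onorm: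
  assumes "\<And>i. (a $ i)\<^sup>2 = \<pi> $ i" and ED: "E ** diag_mat a = mat 1"
  shows "onorm_pi \<pi> A = onorm ((*v) (diag_mat a ** A ** E))"
proof -
  have DE: "diag_mat a ** E = mat 1"
    using ED matrix_left_right_inverse by blast
  have "surj ((*v) E)"
    using ED by (metis matrix_vector_mul_assoc matrix_vector_mul_lid surjI)
  have "onorm_pi \<pi> A = (SUP f\<in>(*v) E ` UNIV. norm (diag_mat a *v (A *v f)) / norm (diag_mat a *v f))"
    unfolding onorm_pi_def \<open>surj ((*v) E)\<close> by (simp add: norm_pi_eq_norm[OF assms(1)])
  also have "\<dots> = onorm ((*v) (diag_mat a ** A ** E))"
    by (simp add: onorm_def image_image matrix_vector_mul_assoc DE matrix_mul_assoc)
  finally show ?thesis .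
qed

text \<open>The weighted inner product is \<open>x \<bullet> (diag_mat \<pi> *v y)\<close>, so the
  adjoint is \<open>transpose A\<close> conjugated by \<open>diag_mat \<pi>\<close>; uniqueness
  identifies it with the description.\<close>

lemma adjoint_pi_eq:
  fixes \<pi> :: "real^'n"
  assumes "\<And>i. \<pi> $ i > 0"
  shows "adjoint_pi \<pi> A = (\<chi> i j. \<pi> $ j * A $ j $ i / \<pi> $ i)" (is "_ = ?B")
  unfolding adjoint_pi_def
proof (rule the1_equality[OF adjoint_pi_exists_unique[OF assms]], intro allI)
  fix f g
  have inner: "inner_pi \<pi> x y = x \<bullet> (diag_mat \<pi> *v y)" for x y
    by (simp add: inner_pi_def inner_vec_def diag_mat_mult_vec mult.commute mult.left_commute)
  have "transpose A ** diag_mat \<pi> = diag_mat \<pi> ** ?B"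
    using assms by (simp add: vec_eq_iff diag_mat_mult_left diag_mat_mult_right transpose_def less_imp_neq[symmetric])
  then show "inner_pi \<pi> (A *v f) g = inner_pi \<pi> f (?B *v g)"
    unfolding inner dot_transpose[of A] by (simp add: matrix_vector_mul_assoc del: transpose_matrix_vector)
qed

text \<open>Jensen's inequality for the square in each row, averaged against \<pi>; after exchanging
  the sums, stationarity restores the weights.\<close>

lemma norm_pi_stochastic_le:
  assumes P: "row_stochastic P" and \<pi>: "stationary_distribution \<pi> P"
  shows "norm_pi \<pi> (P *v f) \<le> norm_pi \<pi> f"
proof -
  have P0: "P $ i $ j \<ge> 0" and P1: "(\<Sum>j\<in>UNIV. P $ i $ j) = 1" for i j
    using P by (auto simp: row_stochastic_def)
  have \<pi>0: "\<pi> $ i \<ge> 0" for i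
    using \<pi> by (simp add: stationary_distribution_def)
  have stat: "(\<Sum>i\<in>UNIV. P $ i $ j * \<pi> $ i) = \<pi> $ j" for j
    using \<pi> by (simp add: stationary_distribution_def vec_eq_iff vector_matrix_mult_def mult.commute)
  have jensen: "((P *v f) $ i)\<^sup>2 \<le> (\<Sum>j\<in>UNIV. P $ i $ j * (f $ j)\<^sup>2)" for i
    using convex_on_sum[OF _ _ convex_power2, of UNIV "\<lambda>j. P $ i $ j" "\<lambda>j. f $ j"] P0 P1
    by (simp add: matrix_vector_mult_def)
  have "(\<Sum>i\<in>UNIV. ((P *v f) $ i)\<^sup>2 * \<pi> $ i) \<le> (\<Sum>i\<in>UNIV. (\<Sum>j\<in>UNIV. P $ i $ j * (f $ j)\<^sup>2) * \<pi> $ i)"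
    by (intro sum_mono mult_right_mono jensen \<pi>0)
  also have "\<dots> = (\<Sum>j\<in>UNIV. \<Sum>i\<in>UNIV. (f $ j)\<^sup>2 * (P $ i $ j * \<pi> $ i))"
    by (simp add: sum_distrib_right sum_distrib_left ac_simps) (rule sum.swap)
  also have "\<dots> = (\<Sum>j\<in>UNIV. (f $ j)\<^sup>2 * \<pi> $ j)"
    by (simp add: stat flip: sum_distrib_left)
  finally show ?thesis
    by (simp add: norm_pi_def inner_pi_def power2_eq_square)
qed

section \<open>Both identities by conjugation to Euclidean space\<close>

theorem mainTheorem3:
  fixes P :: "real^'n^'n" and \<pi> :: "real^'n" and k :: nat
  assumes "CARD('n) \<ge> 2"
    and "row_stochastic P"
    and "irreducible_matrix P"
    and "aperiodic_matrix P"
    and "stationary_distribution \<pi> P"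
    and "\<forall>i. \<pi> $ i > 0"
    and "k \<ge> 1"
  shows "sing_val \<pi> P k 2 = onorm_pi \<pi> (matpow P k ** U_perp \<pi>)
    \<and> onorm_pi \<pi> (matpow P k ** U_perp \<pi>)
        = onorm ((*v) (diag_mat (\<chi> i. (\<pi> $ i) powr (1/2)) ** matpow P k ** U_perp \<pi>
                        ** diag_mat (\<chi> i. (\<pi> $ i) powr (-1/2))))"
proof -
  define u where "u = (\<chi> i. (\<pi> $ i) powr (1/2))"
  define w where "w = (\<chi> i. (\<pi> $ i) powr (-1/2))"
  define D where "D = diag_mat u"
  define E where "E = diag_mat w"
  define M where "M = matpow P k"
  define S where "S = D ** M ** E"
  have pos: "\<pi> $ i > 0" for i
    using assms(6) by blast
  have u2: "(u $ i)\<^sup>2 = \<pi> $ i" for i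
    using pos[of i] by (simp add: u_def powr_half_sqrt)
  have uw: "u $ i * w $ i = 1" for i
    using pos[of i] by (simp add: u_def w_def flip: powr_add)
  have upos: "u $ i > 0" for i
    using pos[of i] by (simp add: u_def)
  have w: "w $ i = 1 / u $ i" for i
    using uw[of i] upos[of i] by (simp add: field_simps)
  have DE: "D ** E = mat 1" and ED: "E ** D = mat 1"
    by (simp_all add: vec_eq_iff D_def E_def diag_mat_mult_left, simp_all add: diag_mat_def mat_def uw mult.commute)
  have tD: "transpose D = D" and tE: "transpose E = E"
    by (auto simp: vec_eq_iff D_def E_def diag_mat_def transpose_def)

  \<comment> \<open>The right fixed vector 1 and the left fixed vector \<pi> of \<open>M\<close> are
    sent to \<open>u\<close> by \<open>D\<close> and \<open>E\<close> respectively, so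
    \<open>S\<close> and \<open>transpose S\<close> both fix \<open>u\<close>.\<close>
  have P1: "P *v 1 = 1"
    using assms(2) by (simp add: row_stochastic_def vec_eq_iff matrix_vector_mult_def)
  have P\<pi>: "transpose P *v \<pi> = \<pi>"
    using assms(5) by (simp add: stationary_distribution_def)
  have M1: "M *v 1 = 1"
    unfolding M_def using P1 by (rule matpow_fixed)
  have M\<pi>: "transpose M *v \<pi> = \<pi>"
    unfolding M_def transpose_matpow using P\<pi> by (rule matpow_fixed)
  have D1: "D *v 1 = u"
    by (simp add: vec_eq_iff D_def diag_mat_mult_vec)
  then have Eu: "E *v u = 1"
    by (metis ED matrix_vector_mul_assoc matrix_vector_mul_lid)
  have Du: "D *v u = \<pi>"
    using u2 by (simp add: vec_eq_iff D_def diag_mat_mult_vec power2_eq_square)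
  then have E\<pi>: "E *v \<pi> = u"
    by (metis ED matrix_vector_mul_assoc matrix_vector_mul_lid)

  have Su: "S *v u = u"
    unfolding S_def by (simp add: Eu M1 D1 flip: matrix_vector_mul_assoc)
  have Stu: "transpose S *v u = u"
    unfolding S_def matrix_transpose_mul tD tE
    by (simp add: Du M\<pi> E\<pi> flip: matrix_vector_mul_assoc del: transpose_matrix_vector)
  have u1: "norm u = 1"
    using assms(5) u2 by (simp add: norm_eq_1 inner_vec_def power2_eq_square stationary_distribution_def)
  have "norm_pi \<pi> (matpow P k *v f) \<le> norm_pi \<pi> f" for f
  proof (induction k)
    case (Suc k)
    then show ?case
      using norm_pi_stochastic_le[OF assms(2,5), of "matpow P k *v f"]
      by (simp flip: matrix_vector_mul_assoc)
  qed simp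
  then have "norm (D *v (M *v f)) \<le> norm (D *v f)" for f
    by (simp add: norm_pi_eq_norm[OF u2] M_def D_def)
  from this[of "E *v _"] have contr: "norm (S *v x) \<le> norm x" for x
    unfolding S_def by (simp add: DE matrix_vector_mul_assoc matrix_mul_assoc)

  \<comment> \<open>The grouping is chosen so that conjugation by \<open>D\<close> cancels the outer
    factors and leaves \<open>E ** transpose P ** D\<close>, the transpose of
    \<open>D ** P ** E\<close>.\<close>
  have adj: "adjoint_pi \<pi> P = E ** (E ** transpose P ** D) ** D"
    using w upos
    by (simp add: adjoint_pi_eq[OF pos] vec_eq_iff D_def E_def diag_mat_mult_left diag_mat_mult_right
        transpose_def field_simps power2_eq_square flip: u2)
  have "D ** matpow (adjoint_pi \<pi> P) k ** E = matpow (D ** adjoint_pi \<pi> P ** E) k"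
    using ED DE by (rule matpow_conj)
  also have "D ** adjoint_pi \<pi> P ** E = (D ** E) ** (E ** transpose P ** D) ** (D ** E)"
    unfolding adj by (simp only: matrix_mul_assoc)
  also have "\<dots> = E ** transpose P ** D"
    by (simp add: DE)
  also have "matpow (E ** transpose P ** D) k = transpose S"
    using matpow_conj[OF DE ED, of "transpose P" k]
    by (simp add: S_def M_def matrix_transpose_mul tD tE transpose_matpow matrix_mul_assoc)
  finally have "D ** matpow (adjoint_pi \<pi> P) k ** E = transpose S" .
  then have "S ** transpose S = D ** M ** (E ** D) ** matpow (adjoint_pi \<pi> P) k ** E"
    unfolding S_def by (metis matrix_mul_assoc)
  then have "S ** transpose S = D ** (M ** matpow (adjoint_pi \<pi> P) k) ** E"
    by (simp add: ED matrix_mul_assoc)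
  then have "charpoly (M ** matpow (adjoint_pi \<pi> P) k) = charpoly (S ** transpose S)"
    by (simp add: charpoly_similar[OF DE])
  then have sv: "sing_val \<pi> P k 2 = sqrt (eigval (S ** transpose S) 2)"
    by (simp add: sing_val_def eigval_def M_def)

  \<comment> \<open>The rank-one part of \<open>U_perp \<pi>\<close> has left factor 1 and right
    factor \<pi>; conjugation turns each into \<open>u\<close>.\<close>
  have "D ** U_perp \<pi> ** E = mat 1 - (\<chi> i j. u $ i * u $ j)"
  proof -
    have \<pi>w: "\<pi> $ j * w $ j = u $ j" for j
      using upos[of j] by (simp add: w power2_eq_square flip: u2)
    have "(D ** U_perp \<pi> ** E) $ i $ j = u $ i * mat 1 $ i $ j * w $ j - u $ i * (\<pi> $ j * w $ j)" for i j
      by (simp add: D_def E_def diag_mat_mult_left diag_mat_mult_right U_perp_def algebra_simps)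
    then show ?thesis
      by (simp add: vec_eq_iff \<pi>w) (simp add: mat_def uw)
  qed
  moreover have "D ** (M ** U_perp \<pi>) ** E = S ** (D ** U_perp \<pi> ** E)"
    unfolding S_def by (metis ED matrix_mul_assoc matrix_mul_rid)
  \<comment> \<open>Since \<open>S\<close> fixes \<open>u\<close>, multiplying by \<open>S\<close>
    leaves the rank-one part unchanged and yields exactly the deflated matrix.\<close>
  moreover have "S ** (\<chi> i j. u $ i * u $ j) = (\<chi> i j. u $ i * u $ j)"
  proof -
    have "(\<Sum>j\<in>UNIV. S $ i $ j * u $ j) = u $ i" for i
      using Su by (simp add: vec_eq_iff matrix_vector_mult_def)
    then show ?thesis
      by (simp add: vec_eq_iff matrix_matrix_mult_def flip: mult.assoc sum_distrib_right)
  qed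
  ultimately have T: "D ** (M ** U_perp \<pi>) ** E = S - (\<chi> i j. u $ i * u $ j)"
    by (simp add: matrix_diff_ldistrib)
  have "onorm_pi \<pi> (M ** U_perp \<pi>) = onorm ((*v) (D ** (M ** U_perp \<pi>) ** E))"
    using onorm_pi_eq_onorm[OF u2] ED unfolding D_def by blast
  moreover have "sing_val \<pi> P k 2 = onorm ((*v) (D ** (M ** U_perp \<pi>) ** E))"
    unfolding sv T using assms(1) u1 Su Stu contr by (rule sqrt_eigval_2_eq_onorm_deflated)
  ultimately show ?thesis
    unfolding u_def[symmetric] w_def[symmetric] D_def[symmetric] E_def[symmetric] M_def[symmetric]
    by (simp add: matrix_mul_assoc)
qed

end
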